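(* For any $a\in\mathbb{R}$ we have the inequalities \[ B_a^+\leq A_a^+\leq 4B_a^+,\qquad B_a^-\leq A_a^-\leq 4B_a^- . \] (All these quantities may be infinite.)
   Context: $S:\mathbb{R}\to\mathbb{R}$ is a strictly increasing continuous function with $\lim_{x\to\pm\infty}S(x)=\pm\infty$, and $m$ is a positive Borel measure on $\mathbb{R}$ with $m(\mathbb{R})<\infty$ (they need not come from a process). $dS$ denotes the Stieltjes measure induced by $S$. For a real function $F$ on $\mathbb{R}$ write $dF\ll dS$ if there is a locally $dS$-integrable function $f$ with $\int_u^v f\,dS=F(v)-F(u)$ for all $u<v$; then $f$ is denoted $\frac{dF}{dS}$. Let \[ \mathcal{F}=\left\{F\in L^2(m):\ dF\ll dS,\ \frac{dF}{dS}\in L^2(dS)\right\}. \] For $a\in\mathbb{R}$, $A_a^+\in[0,\infty]$ is the infimum of the constants $A\in[0,\infty]$ such that \[ \int_{a}^\infty (F(x)-F(a))^2\,dm(x)\leq A\int_a^{\infty} \left(\frac{dF}{dS}\right)^2 dS\quad\text{for all }F\in\mathcal{F}, \] and $A_a^-\in[0,\infty]$ is the infimum of the constants $A\in[0,\infty]$ such that \[ \int_{-\infty}^a (F(x)-F(a))^2\,dm(x)\leq A\int_{-\infty}^{a} \left(\frac{dF}{dS}\right)^2 dS\quad\text{for all }F\in\mathcal{F} \] ($A=\infty$ is always admissible). $B^+_a=\sup_{x\geq a} m(]x,+\infty[)(S(x)-S(a))$ and $B^-_a=\sup_{x\leq a} m(]-\infty,x[)(S(a)-S(x))$. *)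

theory Defs
  imports "HOL-Analysis.Analysis"
begin

definition L2 :: "'a measure \<Rightarrow> ('a \<Rightarrow> real) set" where
  "L2 M = {f \<in> borel_measurable M. integrable M (\<lambda>x. (f x)\<^sup>2)}"

definition locally_integrable :: "real measure \<Rightarrow> (real \<Rightarrow> real) \<Rightarrow> bool" where
  "locally_integrable M f \<longleftrightarrow> (\<forall>u v. set_integrable M {u..v} f)"

text \<open>
  For continuous nondecreasing \<open>S\<close>, \<open>interval_measure S\<close> is the Stieltjes measure \<open>dS\<close>. It has no
  atoms, so it does not matter which endpoints belong to the intervals of integration below.
\<close>

definition is_dS_derivative :: "(real \<Rightarrow> real) \<Rightarrow> (real \<Rightarrow> real) \<Rightarrow> (real \<Rightarrow> real) \<Rightarrow> bool" where
  "is_dS_derivative S F f \<longleftrightarrow>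
     locally_integrable (interval_measure S) f \<and>
     (\<forall>u v. u < v \<longrightarrow> (LINT x:{u<..v}|interval_measure S. f x) = F v - F u)"

definition dS_abs_continuous :: "(real \<Rightarrow> real) \<Rightarrow> (real \<Rightarrow> real) \<Rightarrow> bool" where
  "dS_abs_continuous S F \<longleftrightarrow> (\<exists>f. is_dS_derivative S F f)"

text \<open>
  The derivative \<open>dF/dS\<close> is unique only up to \<open>dS\<close>-null sets; a representative is chosen, and
  all uses below are independent of that choice. The value is meaningful only when
  \<open>dS_abs_continuous S F\<close> holds.
\<close>

definition dS_derivative :: "(real \<Rightarrow> real) \<Rightarrow> (real \<Rightarrow> real) \<Rightarrow> real \<Rightarrow> real" where
  "dS_derivative S F = (SOME f. is_dS_derivative S F f)"

definition dirichlet_domain :: "(real \<Rightarrow> real) \<Rightarrow> real measure \<Rightarrow> (real \<Rightarrow> real) set" where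
  "dirichlet_domain S m =
     {F \<in> L2 m. dS_abs_continuous S F \<and> dS_derivative S F \<in> L2 (interval_measure S)}"

text \<open>
  In \<open>ennreal\<close> one has \<open>\<infinity> * 0 = 0\<close>. This keeps \<open>A = \<infinity>\<close> admissible: if \<open>dF/dS\<close> vanishes
  \<open>dS\<close>-almost everywhere on the half-line, then \<open>F\<close> is constant there and the left-hand side
  is \<open>0\<close> as well.
\<close>

definition A_plus :: "(real \<Rightarrow> real) \<Rightarrow> real measure \<Rightarrow> real \<Rightarrow> ennreal" where
  "A_plus S m a = Inf {A :: ennreal. \<forall>F \<in> dirichlet_domain S m.
     (\<integral>\<^sup>+x\<in>{a..}. ennreal ((F x - F a)\<^sup>2) \<partial>m)
       \<le> A * (\<integral>\<^sup>+x\<in>{a..}. ennreal ((dS_derivative S F x)\<^sup>2) \<partial>interval_measure S)}"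

definition A_minus :: "(real \<Rightarrow> real) \<Rightarrow> real measure \<Rightarrow> real \<Rightarrow> ennreal" where
  "A_minus S m a = Inf {A :: ennreal. \<forall>F \<in> dirichlet_domain S m.
     (\<integral>\<^sup>+x\<in>{..a}. ennreal ((F x - F a)\<^sup>2) \<partial>m)
       \<le> A * (\<integral>\<^sup>+x\<in>{..a}. ennreal ((dS_derivative S F x)\<^sup>2) \<partial>interval_measure S)}"

definition B_plus :: "(real \<Rightarrow> real) \<Rightarrow> real measure \<Rightarrow> real \<Rightarrow> ennreal" where
  "B_plus S m a = (SUP x\<in>{a..}. emeasure m {x<..} * ennreal (S x - S a))"

definition B_minus :: "(real \<Rightarrow> real) \<Rightarrow> real measure \<Rightarrow> real \<Rightarrow> ennreal" where
  "B_minus S m a = (SUP x\<in>{..a}. emeasure m {..<x} * ennreal (S a - S x))"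

end

theory Submission
  imports Defs
begin

text \<open>
  Upper bound: let \<open>s = S - S a\<close> (or \<open>S a - S\<close> on the left half-line) and \<open>f = dF/dS\<close>. Writing the
  square of \<open>\<bar>F x - F a\<bar> \<le> \<integral> \<bar>f\<bar> dS\<close> as a double integral and integrating in \<open>x\<close> first gives
  \<open>\<integral>\<integral> \<bar>f y\<bar> \<bar>f z\<bar> m{s > max (s y) (s z)} \<le> B \<integral>\<integral> \<bar>f y\<bar> \<bar>f z\<bar> / max (s y) (s z)\<close>.
  As \<open>s\<close> pushes \<open>dS\<close> forward to Lebesgue measure, this is a quadratic form with the kernel
  \<open>1 / max y z\<close> on the half-line, and the Schur test with weight \<open>sqrt (y / z)\<close> bounds its norm by
  \<open>4\<close>. Lower bound: test with \<open>S\<close> stopped at \<open>a\<close> and \<open>x\<close>, whose derivative is an indicator.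
\<close>

section \<open>The Schur test and a Hardy inequality along a coordinate \<open>s\<close>\<close>

text \<open>The integral splits at \<open>\<sigma>\<close>: below it the integrand is
  \<open>\<sigma> powr (-1/2) * t powr (-1/2)\<close>, above it
  \<open>\<sigma> powr (1/2) * t powr (-3/2)\<close>. Each piece integrates to 2, whatever
  \<open>\<sigma>\<close> is; this is the origin of the factor 4 in the theorem.\<close>

lemma schur_kernel_integral_le:
  fixes \<sigma> :: real
  assumes "0 < \<sigma>"
  shows "(\<integral>\<^sup>+t. ennreal (if 0 < t then sqrt (\<sigma> / t) / max \<sigma> t else 0) \<partial>lborel) \<le> 4"
proof -
  let ?f = "\<lambda>t. \<sigma> powr (-1/2) * t powr (-1/2)"
  let ?g = "\<lambda>t. \<sigma> powr (1/2) * t powr (-3/2)"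
  have I1: "(?f has_integral \<sigma> powr (-1/2) * (\<sigma> powr (-1/2 + 1) / (-1/2 + 1))) {0..\<sigma>}"
    using has_integral_powr_from_0[of "-1/2" \<sigma>] assms by (intro has_integral_mult_right) simp
  have I2: "(?g has_integral \<sigma> powr (1/2) * (-(\<sigma> powr (-3/2 + 1)) / (-3/2 + 1))) {\<sigma>..}"
    using has_integral_powr_to_inf[of "-3/2" \<sigma>] assms by (intro has_integral_mult_right) simp
  have V1: "\<sigma> powr (-1/2) * (\<sigma> powr (-1/2 + 1) / (-1/2 + 1)) = 2"
    using assms by (simp add: powr_add[symmetric])
  have V2: "\<sigma> powr (1/2) * (-(\<sigma> powr (-3/2 + 1)) / (-3/2 + 1)) = 2"
    using assms by (simp add: powr_add[symmetric])
  have N1: "(\<integral>\<^sup>+t. ennreal (indicator {0..\<sigma>} t * ?f t) \<partial>lborel) = 2"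
    using nn_integral_has_integral_lebesgue[OF _ I1[unfolded V1]] by simp
  have N2: "(\<integral>\<^sup>+t. ennreal (indicator {\<sigma>..} t * ?g t) \<partial>lborel) = 2"
    using nn_integral_has_integral_lebesgue[OF _ I2[unfolded V2]] by simp
  \<comment> \<open>At \<open>t = \<sigma>\<close> both indicators are 1, so the splitting is stated
    as an inequality.\<close>
  have *: "sqrt (\<sigma> / t) / max \<sigma> t \<le> indicator {0..\<sigma>} t * ?f t + indicator {\<sigma>..} t * ?g t"
    if "0 < t" for t
  proof -
    have s: "\<sigma> powr (-1/2) = sqrt \<sigma> / \<sigma>" "t powr (-1/2) = 1 / sqrt t" "\<sigma> powr (1/2) = sqrt \<sigma>"
      using assms that by (simp_all add: powr_half_sqrt powr_minus_divide real_div_sqrt real_divide_square_eq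
        divide_simps)
    have s': "t powr (-3/2) = 1 / sqrt t / t"
    proof -
      have "t powr (-3/2) = t powr (-1/2 + - 1)" by simp
      also have "\<dots> = 1 / sqrt t / t" using that unfolding powr_add s(2) by (simp add: powr_minus_divide)
      finally show ?thesis .
    qed
    show ?thesis
      using assms that unfolding s s' real_sqrt_divide
      by (auto simp: max_def indicator_def mult.commute)
  qed
  have "(\<integral>\<^sup>+t. ennreal (if 0 < t then sqrt (\<sigma> / t) / max \<sigma> t else 0) \<partial>lborel)
      \<le> (\<integral>\<^sup>+t. ennreal (indicator {0..\<sigma>} t * ?f t) + ennreal (indicator {\<sigma>..} t * ?g t) \<partial>lborel)"
    using * by (intro nn_integral_mono) (auto simp: ennreal_plus[symmetric] simp del: ennreal_plus intro!: ennreal_leI)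
  also have "\<dots> = 4"
  proof -
    have "(2::ennreal) + 2 = 4" by simp
    then show ?thesis by (subst nn_integral_add, measurable) (simp only: N1 N2)
  qed
  finally show ?thesis .
qed

text \<open>Formulated on an abstract space with a coordinate \<open>s\<close>, so that one proof
  serves both half-lines: \<open>s\<close> is \<open>S - S a\<close> on the right and
  \<open>S a - S\<close> on the left, and the half-line itself is the region where \<open>s\<close>
  is positive. Since \<open>f\<close> is nonnegative, every integral is a nonnegative one and may be
  infinite, and Tonelli applies throughout.\<close>

lemma hardy_inequality:
  fixes D m :: "'a measure" and s f :: "'a \<Rightarrow> real" and B :: ennreal
  assumes "sigma_finite_measure D" "sigma_finite_measure m"
    and sets_m: "sets m = sets D"
    and [measurable]: "s \<in> borel_measurable D" "f \<in> borel_measurable D"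
    and distr: "distr D borel s = lborel"
    and nonneg: "\<And>y. 0 \<le> f y"
    and tail: "\<And>t. 0 < t \<Longrightarrow> emeasure m {x \<in> space m. t < s x} * ennreal t \<le> B"
  shows "(\<integral>\<^sup>+x. (\<integral>\<^sup>+y. ennreal (f y) * indicator {y. 0 < s y \<and> s y < s x} y \<partial>D)\<^sup>2 \<partial>m)
    \<le> 4 * B * (\<integral>\<^sup>+y. ennreal ((f y)\<^sup>2) * indicator {y. 0 < s y} y \<partial>D)"
proof -
  interpret D: sigma_finite_measure D by fact
  interpret m: sigma_finite_measure m by fact
  interpret DD: pair_sigma_finite D D by unfold_locales
  interpret Dm: pair_sigma_finite D m by unfold_locales
  note sets_m [measurable_cong]
  define p where "p = (\<lambda>x y. ennreal (f y) * indicator {y. 0 < s y \<and> s y < s x} y)"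
  define k where "k = (\<lambda>y z. if 0 < s y \<and> 0 < s z then 1 / max (s y) (s z) else 0)"
  define W where "W = (\<lambda>y z. if 0 < s y \<and> 0 < s z then sqrt (s y / s z) / max (s y) (s z) else 0)"
  have [measurable]: "case_prod p \<in> borel_measurable (m \<Otimes>\<^sub>M D)"
    unfolding p_def by measurable
  have [measurable]: "case_prod k \<in> borel_measurable (D \<Otimes>\<^sub>M D)" "case_prod W \<in> borel_measurable (D \<Otimes>\<^sub>M D)"
    unfolding k_def W_def by measurable
  \<comment> \<open>The product of the two indicators restricts \<open>x\<close> to the set where
    \<open>s x\<close> exceeds \<open>t = max (s y) (s z)\<close>, and \<open>tail\<close> at this
    \<open>t\<close> bounds its measure by \<open>B / t\<close>. This yields the kernel
    \<open>k\<close>.\<close>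
  have inner: "(\<integral>\<^sup>+x. p x y * p x z \<partial>m) \<le> B * ennreal (f y * f z * k y z)" for y z
  proof (cases "0 < s y \<and> 0 < s z")
    case True
    let ?t = "max (s y) (s z)"
    have t: "0 < ?t" using True by auto
    let ?E = "{x \<in> space m. ?t < s x}"
    have "(\<integral>\<^sup>+x. p x y * p x z \<partial>m) = (\<integral>\<^sup>+x. ennreal (f y * f z) * indicator ?E x \<partial>m)"
      using True nonneg by (intro nn_integral_cong) (auto simp: p_def indicator_def ennreal_mult)
    also have "\<dots> = ennreal (f y * f z) * emeasure m ?E"
      by (rule nn_integral_cmult_indicator) measurable
    also have "emeasure m ?E = emeasure m ?E * ennreal ?t * ennreal (1 / ?t)"
      using t by (simp add: mult.assoc ennreal_mult[symmetric])
    also have "\<dots> \<le> B * ennreal (1 / ?t)"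
      by (intro mult_right_mono tail t) simp
    finally have "(\<integral>\<^sup>+x. p x y * p x z \<partial>m) \<le> ennreal (f y * f z) * (B * ennreal (1 / ?t))"
      by (simp add: mult_left_mono)
    also have "\<dots> = B * (ennreal (f y * f z) * ennreal (1 / ?t))"
      by (rule mult.left_commute)
    also have "\<dots> = B * ennreal (f y * f z * k y z)"
      using True nonneg t by (subst ennreal_mult[symmetric]) (simp_all add: k_def)
    finally show ?thesis .
  next
    case False
    then have "(\<integral>\<^sup>+x. p x y * p x z \<partial>m) = (\<integral>\<^sup>+x. 0 \<partial>m)"
      by (intro nn_integral_cong) (auto simp: p_def)
    then show ?thesis by simp
  qed
  \<comment> \<open>Weighted AM-GM: with \<open>r = sqrt (s y / s z)\<close>, expanding
    \<open>(f y * r - f z)\<^sup>2\<close> and dividing by \<open>r\<close> bounds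
    \<open>2 * f y * f z\<close> by \<open>r * (f y)\<^sup>2 + (f z)\<^sup>2 / r\<close>. Multiplied
    by \<open>k\<close>, the weights \<open>r\<close> and \<open>1 / r\<close> become
    \<open>W y z\<close> and \<open>W z y\<close>.\<close>
  have amgm: "f y * f z * k y z \<le> ((f y)\<^sup>2 * W y z + (f z)\<^sup>2 * W z y) / 2" for y z
  proof (cases "0 < s y \<and> 0 < s z")
    case True
    define r where "r = sqrt (s y / s z)"
    have r: "0 < r" "sqrt (s z / s y) = 1 / r"
      using True by (auto simp: r_def real_sqrt_divide)
    have "0 \<le> (f y * r - f z)\<^sup>2" by simp
    then have "2 * (f y * f z) * r \<le> ((f y)\<^sup>2 * r + (f z)\<^sup>2 * (1 / r)) * r"
      using r by (simp add: power2_eq_square algebra_simps)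
    then have "2 * (f y * f z) \<le> (f y)\<^sup>2 * r + (f z)\<^sup>2 * (1 / r)"
      using r by (simp only: mult_le_cancel_right_pos)
    then have "2 * (f y * f z) * k y z \<le> ((f y)\<^sup>2 * r + (f z)\<^sup>2 * (1 / r)) * k y z"
      by (rule mult_right_mono) (use True in \<open>auto simp: k_def\<close>)
    also have "\<dots> = (f y)\<^sup>2 * W y z + (f z)\<^sup>2 * W z y"
      using True r by (simp add: k_def W_def r_def[symmetric] max.commute algebra_simps)
    finally show ?thesis by simp
  qed (auto simp: k_def W_def)
  have W_nonneg: "0 \<le> W y z" for y z by (auto simp: W_def)
  define J where "J = (\<integral>\<^sup>+y. \<integral>\<^sup>+z. ennreal ((f y)\<^sup>2 * W y z) \<partial>D \<partial>D)"
  \<comment> \<open>Since \<open>W y z\<close> depends on \<open>z\<close> only through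
    \<open>s z\<close>, the integral is transported by \<open>s\<close> to Lebesgue measure, where
    the kernel bound applies with \<open>\<sigma> = s y\<close>.\<close>
  have schur: "(\<integral>\<^sup>+z. ennreal (W y z) \<partial>D) \<le> 4 * indicator {y. 0 < s y} y" for y
  proof (cases "0 < s y")
    case True
    have "(\<integral>\<^sup>+z. ennreal (W y z) \<partial>D)
        = (\<integral>\<^sup>+z. ennreal (if 0 < s z then sqrt (s y / s z) / max (s y) (s z) else 0) \<partial>D)"
      using True by (simp add: W_def)
    also have "\<dots> = (\<integral>\<^sup>+t. ennreal (if 0 < t then sqrt (s y / t) / max (s y) t else 0) \<partial>distr D borel s)"
      by (subst nn_integral_distr) auto
    also have "\<dots> \<le> 4"
      unfolding distr by (rule schur_kernel_integral_le[OF True])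
    finally show ?thesis using True by simp
  qed (simp add: W_def)
  \<comment> \<open>The square becomes a double integral over \<open>y\<close> and \<open>z\<close>;
    two exchanges then move the integral over \<open>x\<close> to the innermost place.\<close>
  have "(\<integral>\<^sup>+x. (\<integral>\<^sup>+y. p x y \<partial>D)\<^sup>2 \<partial>m) = (\<integral>\<^sup>+x. \<integral>\<^sup>+y. \<integral>\<^sup>+z. p x y * p x z \<partial>D \<partial>D \<partial>m)"
    by (intro nn_integral_cong)
      (simp add: power2_eq_square nn_integral_cmult nn_integral_multc p_def sets_eq_imp_space_eq[OF sets_m])
  also have "\<dots> = (\<integral>\<^sup>+y. \<integral>\<^sup>+x. \<integral>\<^sup>+z. p x y * p x z \<partial>D \<partial>m \<partial>D)"
    by (rule Dm.Fubini') measurable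
  also have "\<dots> = (\<integral>\<^sup>+y. \<integral>\<^sup>+z. \<integral>\<^sup>+x. p x y * p x z \<partial>m \<partial>D \<partial>D)"
    by (intro nn_integral_cong Dm.Fubini') (simp add: p_def)
  also have "\<dots> \<le> (\<integral>\<^sup>+y. \<integral>\<^sup>+z. B * ennreal (f y * f z * k y z) \<partial>D \<partial>D)"
    by (intro nn_integral_mono inner)
  also have "\<dots> \<le> (\<integral>\<^sup>+y. \<integral>\<^sup>+z. B / 2 * (ennreal ((f y)\<^sup>2 * W y z) + ennreal ((f z)\<^sup>2 * W z y)) \<partial>D \<partial>D)"
  proof (intro nn_integral_mono)
    fix y z
    have "ennreal (f y * f z * k y z) \<le> ennreal (1/2) * ennreal ((f y)\<^sup>2 * W y z + (f z)\<^sup>2 * W z y)"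
      using amgm[of y z] by (subst ennreal_mult[symmetric]) (auto simp: W_nonneg intro!: ennreal_leI)
    also have "\<dots> = ennreal (1/2) * (ennreal ((f y)\<^sup>2 * W y z) + ennreal ((f z)\<^sup>2 * W z y))"
      by (simp add: W_nonneg)
    also have "ennreal (1/2) = 1 / 2" using divide_ennreal[of 1 2] by simp
    finally have "B * ennreal (f y * f z * k y z) \<le> B * (1 / 2 * (ennreal ((f y)\<^sup>2 * W y z) + ennreal ((f z)\<^sup>2 * W z y)))"
      by (rule mult_left_mono) simp
    then show "B * ennreal (f y * f z * k y z) \<le> B / 2 * (ennreal ((f y)\<^sup>2 * W y z) + ennreal ((f z)\<^sup>2 * W z y))"
      by (simp add: divide_ennreal_def mult.assoc)
  qed
  also have "\<dots> = B / 2 * (J + (\<integral>\<^sup>+y. \<integral>\<^sup>+z. ennreal ((f z)\<^sup>2 * W z y) \<partial>D \<partial>D))"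
  proof -
    have "(\<integral>\<^sup>+z. B / 2 * (ennreal ((f y)\<^sup>2 * W y z) + ennreal ((f z)\<^sup>2 * W z y)) \<partial>D)
        = B / 2 * ((\<integral>\<^sup>+z. ennreal ((f y)\<^sup>2 * W y z) \<partial>D) + (\<integral>\<^sup>+z. ennreal ((f z)\<^sup>2 * W z y) \<partial>D))"
      if "y \<in> space D" for y
    proof -
      note that [measurable]
      show ?thesis
        by (subst nn_integral_cmult, measurable, subst nn_integral_add, measurable)
    qed
    then have "(\<integral>\<^sup>+y. \<integral>\<^sup>+z. B / 2 * (ennreal ((f y)\<^sup>2 * W y z) + ennreal ((f z)\<^sup>2 * W z y)) \<partial>D \<partial>D)
      = (\<integral>\<^sup>+y. B / 2 * ((\<integral>\<^sup>+z. ennreal ((f y)\<^sup>2 * W y z) \<partial>D) + (\<integral>\<^sup>+z. ennreal ((f z)\<^sup>2 * W z y) \<partial>D)) \<partial>D)"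
      by (rule nn_integral_cong)
    also have "\<dots> = B / 2 * (J + (\<integral>\<^sup>+y. \<integral>\<^sup>+z. ennreal ((f z)\<^sup>2 * W z y) \<partial>D \<partial>D))"
      unfolding J_def by (subst nn_integral_cmult, measurable, subst nn_integral_add, measurable)
    finally show ?thesis .
  qed
  \<comment> \<open>Exchanging the names of \<open>y\<close> and \<open>z\<close> turns the second
    half into the first, so only the one Schur bound on \<open>W\<close> is required.\<close>
  also have "(\<integral>\<^sup>+y. \<integral>\<^sup>+z. ennreal ((f z)\<^sup>2 * W z y) \<partial>D \<partial>D) = J"
    unfolding J_def by (rule DD.Fubini') measurable
  also have "B / 2 * (J + J) = B * J"
  proof -
    have "B / 2 * (J + J) = B * (2 / 2) * J"
      by (simp only: mult_2[symmetric] divide_ennreal_def mult_ac)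
    then show ?thesis by simp
  qed
  also have "J \<le> (\<integral>\<^sup>+y. ennreal ((f y)\<^sup>2) * (4 * indicator {y. 0 < s y} y) \<partial>D)"
    unfolding J_def using schur W_nonneg
    by (intro nn_integral_mono) (simp add: ennreal_mult nn_integral_cmult mult_left_mono)
  also have "\<dots> = 4 * (\<integral>\<^sup>+y. ennreal ((f y)\<^sup>2) * indicator {y. 0 < s y} y \<partial>D)"
    by (simp add: mult.left_commute nn_integral_cmult)
  finally show ?thesis
    unfolding p_def by (simp add: mult_left_mono mult.assoc mult.left_commute[of B])
qed

section \<open>The Stieltjes measure of a continuous function and its image under
  \<open>S\<close>\<close>

lemma at_right_continuous_of_continuous:
  fixes F :: "real \<Rightarrow> real"
  assumes "continuous_on UNIV F"
  shows "continuous (at_right x) F"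
  using assms continuous_within_subset[of x UNIV F "{x<..}"] by (simp add: continuous_on_eq_continuous_within)

lemma emeasure_stieltjes_singleton:
  fixes S :: "real \<Rightarrow> real"
  assumes "mono S" "continuous_on UNIV S"
  shows "emeasure (interval_measure S) {x} = 0"
  using emeasure_interval_measure_Icc[of x x S] assms by (simp add: mono_def)

text \<open>The half-open interval has this measure by construction, and its right endpoint is a
  null set. Open intervals are the sets on which Lebesgue measure is identified below.\<close>

lemma emeasure_stieltjes_Ioo:
  fixes S :: "real \<Rightarrow> real"
  assumes "mono S" "continuous_on UNIV S" "p \<le> q"
  shows "emeasure (interval_measure S) {p<..<q} = ennreal (S q - S p)"
proof -
  have "AE x in interval_measure S. x \<noteq> q"
    using emeasure_stieltjes_singleton[OF assms(1,2)] by (intro AE_I[of _ _ "{q}"]) auto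
  then have "emeasure (interval_measure S) {p<..<q} = emeasure (interval_measure S) {p<..q}"
    by (intro emeasure_eq_AE) auto
  also have "\<dots> = ennreal (S q - S p)"
    using assms by (intro emeasure_interval_measure_Ioc at_right_continuous_of_continuous) (auto simp: mono_def)
  finally show ?thesis .
qed

lemma surj_of_continuous_limits:
  fixes S :: "real \<Rightarrow> real"
  assumes S: "continuous_on UNIV S"
    and lim: "filterlim S at_top at_top" "filterlim S at_bot at_bot"
  shows "surj S"
proof -
  have "\<exists>x. S x = t" for t
  proof -
    obtain p where p: "S x \<le> t" if "x \<le> p" for x
      using lim(2) by (auto simp: filterlim_at_bot eventually_at_bot_linorder)
    obtain q where q: "t \<le> S x" if "q \<le> x" for x
      using lim(1) by (auto simp: filterlim_at_top eventually_at_top_linorder)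
    have "min p q \<le> max p q" by simp
    then show ?thesis
      using IVT'[of S "min p q" t "max p q"] p[of "min p q"] q[of "max p q"] continuous_on_subset[OF S] by auto
  qed
  then show ?thesis by (metis surjI)
qed

text \<open>By surjectivity the endpoints of an open interval are values \<open>S p\<close> and
  \<open>S q\<close>. By strict monotonicity its preimage is the open interval from \<open>p\<close>
  to \<open>q\<close>, whose measure is \<open>S q - S p\<close>, and open intervals determine
  Lebesgue measure.\<close>

lemma distr_stieltjes:
  fixes S :: "real \<Rightarrow> real"
  assumes S: "strict_mono S" "continuous_on UNIV S"
    and lim: "filterlim S at_top at_top" "filterlim S at_bot at_bot"
  shows "distr (interval_measure S) borel S = lborel"
proof (rule lborel_eqI[symmetric])
  have [measurable]: "S \<in> borel_measurable borel"
    using S(2) by (rule borel_measurable_continuous_onI)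
  fix l u :: real
  assume "\<And>b. b \<in> Basis \<Longrightarrow> l \<bullet> b \<le> u \<bullet> b"
  then have lu: "l \<le> u" by simp
  obtain p q where pq: "S p = l" "S q = u"
    using surj_of_continuous_limits[OF S(2) lim] by (metis surjD)
  have "S -` box l u = {p<..<q}"
    using strict_mono_less[OF S(1)] unfolding pq[symmetric] by (auto simp: box_real)
  moreover have "p \<le> q" using lu strict_mono_less_eq[OF S(1)] unfolding pq[symmetric] by simp
  ultimately show "emeasure (distr (interval_measure S) borel S) (box l u) = (\<Prod>b\<in>Basis. (u - l) \<bullet> b)"
    using emeasure_stieltjes_Ioo[OF strict_mono_mono[OF S(1)] S(2)] pq
    by (subst emeasure_distr) auto
qed simp

text \<open>Lebesgue measure is invariant under translation and reflection. With
  \<open>c = S a\<close> these are the coordinates of the right and the left half-line.\<close>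

lemma distr_stieltjes_shift:
  fixes S :: "real \<Rightarrow> real"
  assumes S: "strict_mono S" "continuous_on UNIV S"
    and lim: "filterlim S at_top at_top" "filterlim S at_bot at_bot"
  shows "distr (interval_measure S) borel (\<lambda>x. S x - c) = lborel"
    and "distr (interval_measure S) borel (\<lambda>x. c - S x) = lborel"
proof -
  have [measurable]: "S \<in> borel_measurable borel"
    using S(2) by (rule borel_measurable_continuous_onI)
  note D = distr_stieltjes[OF assms]
  have "distr (interval_measure S) borel (\<lambda>x. S x - c) = distr lborel borel ((+) (- c))"
    unfolding D[symmetric] by (subst distr_distr) (auto simp: comp_def)
  then show "distr (interval_measure S) borel (\<lambda>x. S x - c) = lborel"
    by (simp add: lborel_distr_plus)
  have "distr (interval_measure S) borel (\<lambda>x. c - S x) = distr (distr lborel borel uminus) borel ((+) c)"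
    unfolding D[symmetric] by (subst distr_distr, simp, simp, subst distr_distr) (auto simp: comp_def)
  then show "distr (interval_measure S) borel (\<lambda>x. c - S x) = lborel"
    by (simp add: lborel_distr_uminus lborel_distr_plus)
qed

section \<open>Uniqueness of the derivative with respect to \<open>S\<close>\<close>

text \<open>Local integrability makes the truncations of \<open>f\<close> to \<open>[-n, n]\<close>
  measurable, and \<open>f\<close> is their pointwise limit.\<close>

lemma locally_integrable_borel_measurable:
  assumes "locally_integrable M f" "sets M = sets borel"
  shows "f \<in> borel_measurable borel"
proof (rule borel_measurable_LIMSEQ_real)
  fix n :: nat
  have "set_integrable M {- real n..real n} f"
    using assms(1) by (simp add: locally_integrable_def)
  then have "(\<lambda>x. indicator {- real n..real n} x *\<^sub>R f x) \<in> borel_measurable M"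
    unfolding set_integrable_def by (rule borel_measurable_integrable)
  then show "(\<lambda>x. indicator {- real n..real n} x * f x) \<in> borel_measurable borel"
    using assms(2) by (simp cong: measurable_cong_sets)
next
  fix x :: real
  obtain N :: nat where "\<bar>x\<bar> \<le> real N" using real_arch_simple by blast
  then have "eventually (\<lambda>n. indicator {- real n..real n} x * f x = f x) sequentially"
    by (intro eventually_sequentiallyI[of N]) (auto simp: indicator_def)
  then show "(\<lambda>n. indicator {- real n..real n} x * f x) \<longlonglongrightarrow> f x"
    by (rule tendsto_eventually)
qed

lemma locally_integrable_Ioc:
  assumes "locally_integrable M f" "sets M = sets borel"
  shows "set_integrable M {u<..v} f"
proof (rule set_integrable_subset)
  show "set_integrable M {u..v} f" using assms(1) by (simp add: locally_integrable_def)
  show "{u<..v} \<in> sets M" unfolding assms(2) by simp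
  show "{u<..v} \<subseteq> {u..v}" by (rule greaterThanAtMost_subseteq_atLeastAtMost_iff[THEN iffD2]) simp
qed

text \<open>On a bounded interval the positive and negative parts of \<open>h\<close> are densities
  of finite measures that agree on all rays, hence everywhere. By uniqueness of densities the two
  parts coincide almost everywhere, which forces \<open>h = 0\<close> there.\<close>

lemma locally_integrable_AE_zero:
  fixes h :: "real \<Rightarrow> real"
  assumes "sigma_finite_measure M" and sets_M: "sets M = sets borel"
    and h: "locally_integrable M h"
    and zero: "\<And>u v. u < v \<Longrightarrow> (LINT x:{u<..v}|M. h x) = 0"
  shows "AE x in M. h x = 0"
proof -
  interpret sigma_finite_measure M by fact
  note sets_M [measurable_cong]
  have [measurable]: "h \<in> borel_measurable borel"
    using locally_integrable_borel_measurable[OF h sets_M] .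
  have "AE x in M. - real n < x \<and> x \<le> real n \<longrightarrow> h x = 0" for n :: nat
  proof -
    let ?I = "{- real n<..real n}"
    \<comment> \<open>These are the positive and negative parts of the truncated \<open>h\<close>,
      because \<open>ennreal\<close> sends negative reals to 0.\<close>
    define p where "p = (\<lambda>x. ennreal (indicator ?I x * h x))"
    define q where "q = (\<lambda>x. ennreal (- (indicator ?I x * h x)))"
    have [measurable]: "p \<in> borel_measurable M" "q \<in> borel_measurable M"
      unfolding p_def q_def by measurable
    \<comment> \<open>The truncation replaces the ray by a bounded half-open interval, on which the
      integral of \<open>h\<close> vanishes; this interval is empty once \<open>c\<close> reaches
      \<open>real n\<close>.\<close>
    have ray: "(\<integral>\<^sup>+x. p x * indicator {c<..} x \<partial>M) = (\<integral>\<^sup>+x. q x * indicator {c<..} x \<partial>M) \<and>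
        (\<integral>\<^sup>+x. q x * indicator {c<..} x \<partial>M) < \<infinity>" for c
    proof -
      let ?J = "{max c (- real n)<..real n}"
      let ?k = "\<lambda>x. indicator ?J x * h x"
      have int: "integrable M ?k"
        using locally_integrable_Ioc[OF h sets_M] by (simp add: set_integrable_def)
      have "(LINT x|M. ?k x) = 0"
      proof (cases "max c (- real n) < real n")
        case True
        then show ?thesis using zero by (simp add: set_lebesgue_integral_def)
      next
        case False
        then have "?J = {}" by simp
        then show ?thesis unfolding \<open>?J = {}\<close> by simp
      qed
      moreover have fin: "(\<integral>\<^sup>+x. ennreal (?k x) \<partial>M) \<noteq> \<infinity>" "(\<integral>\<^sup>+x. ennreal (- ?k x) \<partial>M) \<noteq> \<infinity>"
        using int by (auto simp: real_integrable_def)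
      ultimately have "(\<integral>\<^sup>+x. ennreal (?k x) \<partial>M) = (\<integral>\<^sup>+x. ennreal (- ?k x) \<partial>M)"
        using real_lebesgue_integral_def[OF int]
        by (metis (no_types, lifting) ennreal_enn2real_if eq_iff_diff_eq_0 infinity_ennreal_def)
      moreover have "p x * indicator {c<..} x = ennreal (?k x)" for x
        by (auto simp: p_def indicator_def)
      moreover have "q x * indicator {c<..} x = ennreal (- ?k x)" for x
        by (auto simp: q_def indicator_def)
      ultimately show ?thesis using fin by (simp add: top.not_eq_extremum)
    qed
    have "density M p = density M q"
    proof (rule measure_eqI_lessThan)
      fix c :: real
      show "emeasure (density M p) {c<..} < \<infinity>"
        using ray[of c] by (simp add: emeasure_density sets_M)
      show "emeasure (density M p) {c<..} = emeasure (density M q) {c<..}"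
        using ray[of c] by (simp add: emeasure_density sets_M)
    qed (simp_all add: sets_M)
    then have "AE x in M. p x = q x"
      by (intro density_unique) simp_all
    then show ?thesis
    proof eventually_elim
      case (elim x)
      have "r = 0" if "ennreal r = ennreal (- r)" for r
        using that by (cases "0 \<le> r") (auto simp: ennreal_neg ennreal_eq_0_iff dest: sym)
      with elim show ?case by (auto simp: p_def q_def)
    qed
  qed
  then have "AE x in M. \<forall>n::nat. - real n < x \<and> x \<le> real n \<longrightarrow> h x = 0"
    unfolding AE_all_countable by blast
  then show ?thesis
  proof eventually_elim
    case (elim x)
    obtain n :: nat where "\<bar>x\<bar> < real n" using reals_Archimedean2 by blast
    then have "- real n < x \<and> x \<le> real n" by auto
    then show ?case using elim by blast
  qed
qed

text \<open>Since \<open>dS_derivative\<close> is an arbitrary choice, this is what allows it to be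
  replaced by an explicit derivative under an integral.\<close>

lemma is_dS_derivative_unique:
  fixes S :: "real \<Rightarrow> real"
  assumes "mono S" "continuous_on UNIV S"
    and f: "is_dS_derivative S F f" and g: "is_dS_derivative S F g"
  shows "AE x in interval_measure S. f x = g x"
proof -
  have sf: "sigma_finite_measure (interval_measure S)"
    using assms(1,2) by (intro sigma_finite_interval_measure at_right_continuous_of_continuous) (auto simp: mono_def)
  have "AE x in interval_measure S. f x - g x = 0"
  proof (rule locally_integrable_AE_zero[OF sf])
    show "locally_integrable (interval_measure S) (\<lambda>x. f x - g x)"
      using f g by (auto simp: is_dS_derivative_def locally_integrable_def)
    fix u v :: real assume "u < v"
    moreover have "set_integrable (interval_measure S) {u<..v} f" "set_integrable (interval_measure S) {u<..v} g"
      using f g by (auto simp: is_dS_derivative_def intro!: locally_integrable_Ioc)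
    ultimately show "(LINT x:{u<..v}|interval_measure S. f x - g x) = 0"
      using f g by (simp add: is_dS_derivative_def)
  qed simp
  then show ?thesis by simp
qed

lemma is_dS_derivative_dS_derivative:
  "is_dS_derivative S F f \<Longrightarrow> is_dS_derivative S F (dS_derivative S F)"
  unfolding dS_derivative_def by (rule someI[of "is_dS_derivative S F"])

section \<open>Test functions and increments\<close>

text \<open>\<open>F\<close> is \<open>S\<close> stopped at \<open>u\<close> and \<open>v\<close>.
  It is bounded, hence square integrable for the finite measure \<open>m\<close>, and its derivative
  is the indicator of \<open>{u<..v}\<close>, whose square is itself. Its energy is thus
  \<open>S v - S u\<close> on the whole line and at most that on any \<open>E\<close>.\<close>

lemma clamp_test_function:
  fixes S :: "real \<Rightarrow> real"
  assumes S: "mono S" "continuous_on UNIV S" and m: "finite_measure m" "sets m = sets borel"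
    and uv: "u \<le> v"
  defines "F \<equiv> \<lambda>x. S (max u (min x v))"
  shows "F \<in> dirichlet_domain S m"
    and "(\<integral>\<^sup>+x\<in>E. ennreal ((dS_derivative S F x)\<^sup>2) \<partial>interval_measure S) \<le> ennreal (S v - S u)"
proof -
  interpret m: finite_measure m by fact
  let ?D = "interval_measure S"
  have Ioc: "emeasure ?D {p<..q} = ennreal (S q - S p)" if "p \<le> q" for p q
    using S that by (intro emeasure_interval_measure_Ioc at_right_continuous_of_continuous) (auto simp: mono_def)
  have ind: "is_dS_derivative S F (indicator {u<..v})"
    unfolding is_dS_derivative_def locally_integrable_def set_integrable_def
  proof (intro conjI allI impI)
    fix p q :: real
    have "integrable ?D (indicator ({p..q} \<inter> {u<..v}) :: real \<Rightarrow> real)"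
    proof (rule integrable_real_indicator)
      have "emeasure ?D ({p..q} \<inter> {u<..v}) \<le> emeasure ?D {u<..v}"
        by (intro emeasure_mono) auto
      then show "emeasure ?D ({p..q} \<inter> {u<..v}) < \<infinity>"
        using Ioc[OF uv] by (auto simp: le_less_trans)
    qed simp
    then show "integrable ?D (\<lambda>x. indicator {p..q} x *\<^sub>R indicator {u<..v} x :: real)"
      by (rule back_subst[where P="integrable ?D"]) (auto simp: indicator_def fun_eq_iff)
    assume "p < q"
    let ?c = "\<lambda>x. max u (min x v)"
    have "(LINT x:{p<..q}|?D. indicator {u<..v} x :: real) = measure ?D ({p<..q} \<inter> {u<..v})"
      by (simp add: set_lebesgue_integral_def indicator_inter_arith[symmetric])
    \<comment> \<open>Intersecting with \<open>{u<..v}\<close> clamps both endpoints. If the clamped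
      endpoints coincide, the interval is empty and the increment of \<open>F\<close> is 0.\<close>
    also have "{p<..q} \<inter> {u<..v} = {?c p<..?c q}"
      using \<open>p < q\<close> uv by auto
    also have "measure ?D \<dots> = F q - F p"
      using \<open>p < q\<close> S(1) by (auto simp: measure_def Ioc F_def mono_def)
    finally show "(LINT x:{p<..q}|?D. indicator {u<..v} x) = F q - F p" .
  qed
  note der = is_dS_derivative_dS_derivative[OF ind]
  have AE: "AE x in ?D. dS_derivative S F x = indicator {u<..v} x"
    using is_dS_derivative_unique[OF S der ind] .
  have [measurable]: "dS_derivative S F \<in> borel_measurable borel"
    using der by (auto simp: is_dS_derivative_def intro: locally_integrable_borel_measurable)
  have AE2: "AE x in ?D. (dS_derivative S F x)\<^sup>2 = indicator {u<..v} x"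
    using AE by eventually_elim (auto simp: indicator_def)
  have "integrable ?D (\<lambda>x. (dS_derivative S F x)\<^sup>2) \<longleftrightarrow> integrable ?D (indicator {u<..v} :: real \<Rightarrow> real)"
    using AE2 by (intro integrable_cong_AE) auto
  moreover have "integrable ?D (indicator {u<..v} :: real \<Rightarrow> real)"
    using Ioc[OF uv] by (intro integrable_real_indicator) auto
  ultimately have L2D: "dS_derivative S F \<in> L2 ?D"
    by (auto simp: L2_def cong: measurable_cong_sets)
  have [measurable]: "S \<in> borel_measurable borel"
    using S(2) by (rule borel_measurable_continuous_onI)
  have Fm: "F \<in> borel_measurable m"
    unfolding F_def measurable_cong_sets[OF m(2) refl] by measurable
  have "\<bar>F x\<bar> \<le> max \<bar>S u\<bar> \<bar>S v\<bar>" for x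
  proof -
    have "S u \<le> F x" "F x \<le> S v"
      using uv S(1) by (auto simp: F_def mono_def)
    then show ?thesis by auto
  qed
  then have "\<bar>(F x)\<^sup>2\<bar> \<le> (max \<bar>S u\<bar> \<bar>S v\<bar>)\<^sup>2" for x
    by (simp add: abs_le_square_iff[symmetric])
  then have "integrable m (\<lambda>x. (F x)\<^sup>2)"
    using Fm by (intro m.integrable_const_bound[where B="(max \<bar>S u\<bar> \<bar>S v\<bar>)\<^sup>2"]) auto
  then have "F \<in> L2 m" using Fm by (simp add: L2_def)
  then show "F \<in> dirichlet_domain S m"
    using L2D ind by (auto simp: dirichlet_domain_def dS_abs_continuous_def)
  have "(\<integral>\<^sup>+x\<in>E. ennreal ((dS_derivative S F x)\<^sup>2) \<partial>?D) \<le> (\<integral>\<^sup>+x. indicator {u<..v} x \<partial>?D)"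
    using AE2 by (intro nn_integral_mono_AE) (auto simp: indicator_def split: if_splits)
  also have "\<dots> = ennreal (S v - S u)"
    using Ioc[OF uv] by simp
  finally show "(\<integral>\<^sup>+x\<in>E. ennreal ((dS_derivative S F x)\<^sup>2) \<partial>?D) \<le> ennreal (S v - S u)" .
qed

text \<open>The triangle inequality for the integral, with the null point \<open>v\<close> removed.
  The open interval matches the strict condition \<open>0 < s y \<and> s y < s x\<close> of the
  Hardy inequality for either orientation of the half-line.\<close>

lemma dS_increment_le:
  fixes S :: "real \<Rightarrow> real"
  assumes S: "mono S" "continuous_on UNIV S" and f: "is_dS_derivative S F f" and "u \<le> v"
  shows "ennreal \<bar>F v - F u\<bar> \<le> (\<integral>\<^sup>+y\<in>{u<..<v}. ennreal \<bar>f y\<bar> \<partial>interval_measure S)"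
proof (cases "u = v")
  case False
  let ?D = "interval_measure S"
  have uv: "u < v" using False \<open>u \<le> v\<close> by simp
  have int: "integrable ?D (\<lambda>y. indicator {u<..v} y *\<^sub>R f y)"
    using f locally_integrable_Ioc[of ?D f] by (simp add: is_dS_derivative_def set_integrable_def)
  have AE: "AE y in ?D. y \<noteq> v"
    using emeasure_stieltjes_singleton[OF S] by (intro AE_I[of _ _ "{v}"]) auto
  have "F v - F u = (LINT y|?D. indicator {u<..v} y *\<^sub>R f y)"
    using f uv by (simp add: is_dS_derivative_def set_lebesgue_integral_def)
  then have "ennreal \<bar>F v - F u\<bar> \<le> (\<integral>\<^sup>+y. ennreal (norm (indicator {u<..v} y *\<^sub>R f y)) \<partial>?D)"
    using integral_norm_bound_ennreal[OF int] by simp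
  also have "\<dots> = (\<integral>\<^sup>+y\<in>{u<..<v}. ennreal \<bar>f y\<bar> \<partial>?D)"
    using AE by (intro nn_integral_cong_AE, eventually_elim) (auto simp: indicator_def)
  finally show ?thesis .
qed simp

section \<open>Both bounds in a form common to the two half-lines\<close>

text \<open>The Hardy inequality is applied to the absolute value of the derivative. Here
  \<open>E\<close> is the closed half-line starting at \<open>a\<close>, and \<open>min\<close> and
  \<open>max\<close> in \<open>between\<close> let it extend to either side: points strictly between
  \<open>a\<close> and \<open>x\<close> have a positive coordinate below that of
  \<open>x\<close>.\<close>

lemma dirichlet_hardy:
  fixes S s :: "real \<Rightarrow> real" and m :: "real measure"
  assumes S: "mono S" "continuous_on UNIV S" and m: "finite_measure m" "sets m = sets borel"
    and F: "F \<in> dirichlet_domain S m"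
    and s: "s \<in> borel_measurable borel" "distr (interval_measure S) borel s = lborel"
    and tail: "\<And>t. 0 < t \<Longrightarrow> emeasure m {x. t < s x} * ennreal t \<le> B"
    and between: "\<And>x. x \<in> E \<Longrightarrow> {min a x<..<max a x} \<subseteq> {y. 0 < s y \<and> s y < s x}"
    and pos: "{y. 0 < s y} \<subseteq> E"
  shows "(\<integral>\<^sup>+x\<in>E. ennreal ((F x - F a)\<^sup>2) \<partial>m)
    \<le> 4 * B * (\<integral>\<^sup>+x\<in>E. ennreal ((dS_derivative S F x)\<^sup>2) \<partial>interval_measure S)"
proof -
  let ?D = "interval_measure S" and ?f = "dS_derivative S F"
  have der: "is_dS_derivative S F ?f"
    using F is_dS_derivative_dS_derivative by (auto simp: dirichlet_domain_def dS_abs_continuous_def)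
  have sf: "sigma_finite_measure ?D"
    using S by (intro sigma_finite_interval_measure at_right_continuous_of_continuous) (auto simp: mono_def)
  have sfm: "sigma_finite_measure m"
    using m(1) by (simp add: finite_measure_def)
  have fm: "?f \<in> borel_measurable borel"
    using der by (auto simp: is_dS_derivative_def intro: locally_integrable_borel_measurable)
  have sp: "space m = UNIV" using sets_eq_imp_space_eq[OF m(2)] by simp
  have "(\<integral>\<^sup>+x\<in>E. ennreal ((F x - F a)\<^sup>2) \<partial>m)
      \<le> (\<integral>\<^sup>+x. (\<integral>\<^sup>+y. ennreal \<bar>?f y\<bar> * indicator {y. 0 < s y \<and> s y < s x} y \<partial>?D)\<^sup>2 \<partial>m)"
  proof (rule nn_integral_mono)
    fix x
    show "ennreal ((F x - F a)\<^sup>2) * indicator E x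
        \<le> (\<integral>\<^sup>+y. ennreal \<bar>?f y\<bar> * indicator {y. 0 < s y \<and> s y < s x} y \<partial>?D)\<^sup>2"
    proof (cases "x \<in> E")
      case True
      have "ennreal \<bar>F x - F a\<bar> = ennreal \<bar>F (max a x) - F (min a x)\<bar>"
        by (cases "a \<le> x") (auto simp: max_def min_def abs_minus_commute)
      also have "\<dots> \<le> (\<integral>\<^sup>+y\<in>{min a x<..<max a x}. ennreal \<bar>?f y\<bar> \<partial>?D)"
        by (rule dS_increment_le[OF S der]) simp
      also have "\<dots> \<le> (\<integral>\<^sup>+y. ennreal \<bar>?f y\<bar> * indicator {y. 0 < s y \<and> s y < s x} y \<partial>?D)"
        using between[OF True] by (intro nn_integral_mono) (auto simp: indicator_def)
      finally have "(ennreal \<bar>F x - F a\<bar>)\<^sup>2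
          \<le> (\<integral>\<^sup>+y. ennreal \<bar>?f y\<bar> * indicator {y. 0 < s y \<and> s y < s x} y \<partial>?D)\<^sup>2"
        by (rule power_mono) simp
      then show ?thesis using True by (simp add: ennreal_power)
    qed simp
  qed
  also have "\<dots> \<le> 4 * B * (\<integral>\<^sup>+y. ennreal (\<bar>?f y\<bar>\<^sup>2) * indicator {y. 0 < s y} y \<partial>?D)"
    using sf sfm m(2) s fm tail by (intro hardy_inequality) (simp_all add: sp cong: measurable_cong_sets)
  also have "\<dots> \<le> 4 * B * (\<integral>\<^sup>+x\<in>E. ennreal ((?f x)\<^sup>2) \<partial>?D)"
    using pos by (intro mult_left_mono nn_integral_mono) (auto simp: indicator_def)
  finally show ?thesis .
qed

text \<open>On \<open>U\<close> the stopped function differs from its value at \<open>a\<close> by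
  the full jump \<open>c = S v - S u\<close>, while its energy is at most \<open>c\<close>. Hence
  \<open>c\<^sup>2 * m(U) \<le> A * c\<close>, and \<open>c\<close> cancels. On the right
  \<open>u = a\<close>, \<open>v = x\<close> and \<open>U = {x<..}\<close>; on the left
  \<open>u = x\<close>, \<open>v = a\<close> and \<open>U = {..<x}\<close>.\<close>

lemma emeasure_mult_le_of_test:
  fixes S :: "real \<Rightarrow> real" and m :: "real measure"
  assumes S: "mono S" "continuous_on UNIV S" and m: "finite_measure m" "sets m = sets borel"
    and "u \<le> v" and U: "U \<in> sets borel" "U \<subseteq> E"
    and jump: "\<And>x. x \<in> U \<Longrightarrow> \<bar>S (max u (min x v)) - S (max u (min a v))\<bar> = S v - S u"
    and A: "\<forall>F \<in> dirichlet_domain S m. (\<integral>\<^sup>+x\<in>E. ennreal ((F x - F a)\<^sup>2) \<partial>m)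
       \<le> A * (\<integral>\<^sup>+x\<in>E. ennreal ((dS_derivative S F x)\<^sup>2) \<partial>interval_measure S)"
  shows "emeasure m U * ennreal (S v - S u) \<le> A"
proof (cases "S v - S u = 0")
  case False
  define c where "c = S v - S u"
  have c: "0 < c" using S(1) \<open>u \<le> v\<close> False by (auto simp: mono_def c_def less_le)
  let ?F = "\<lambda>x. S (max u (min x v))"
  note T = clamp_test_function[OF S m \<open>u \<le> v\<close>]
  have "(\<integral>\<^sup>+x. ennreal (c\<^sup>2) * indicator U x \<partial>m) \<le> (\<integral>\<^sup>+x\<in>E. ennreal ((?F x - ?F a)\<^sup>2) \<partial>m)"
  proof (rule nn_integral_mono)
    fix x show "ennreal (c\<^sup>2) * indicator U x \<le> ennreal ((?F x - ?F a)\<^sup>2) * indicator E x"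
    proof (cases "x \<in> U")
      case True
      have "(?F x - ?F a)\<^sup>2 = c\<^sup>2" using jump[OF True] by (metis c_def power2_abs)
      then show ?thesis using True U by auto
    qed simp
  qed
  also have "\<dots> \<le> A * (\<integral>\<^sup>+x\<in>E. ennreal ((dS_derivative S ?F x)\<^sup>2) \<partial>interval_measure S)"
    using bspec[OF A T(1)] .
  also have "\<dots> \<le> A * ennreal c"
    unfolding c_def by (intro mult_left_mono T(2)) simp
  finally have "ennreal (c\<^sup>2) * emeasure m U \<le> A * ennreal c"
    using U(1) m(2) by (simp add: nn_integral_cmult_indicator)
  \<comment> \<open>Cancelling by multiplication with \<open>1 / c\<close> is valid for infinite
    \<open>A\<close> too, as \<open>c\<close> is positive and finite.\<close>
  then have "ennreal (c\<^sup>2) * emeasure m U * ennreal (1 / c) \<le> A * ennreal c * ennreal (1 / c)"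
    by (rule mult_right_mono) simp
  moreover have "A * ennreal c * ennreal (1 / c) = A"
    using c by (simp add: mult.assoc ennreal_mult[symmetric])
  moreover have "ennreal (c\<^sup>2) * emeasure m U * ennreal (1 / c) = emeasure m U * ennreal c"
  proof -
    have "ennreal (c\<^sup>2) * ennreal (1 / c) = ennreal c"
      using c by (simp add: ennreal_mult[symmetric] power2_eq_square)
    then show ?thesis by (metis mult.assoc mult.commute)
  qed
  ultimately show ?thesis by (simp add: c_def)
qed simp

theorem theorem2p1:
  fixes S :: "real \<Rightarrow> real" and m :: "real measure" and a :: real
  assumes "strict_mono S"
    and "continuous_on UNIV S"
    and "filterlim S at_top at_top"
    and "filterlim S at_bot at_bot"
    and "sets m = sets borel"
    and "emeasure m UNIV < \<infinity>"
  shows "B_plus S m a \<le> A_plus S m a \<and> A_plus S m a \<le> 4 * B_plus S m a \<and>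
         B_minus S m a \<le> A_minus S m a \<and> A_minus S m a \<le> 4 * B_minus S m a"
proof (intro conjI)
  note S = strict_mono_mono[OF assms(1)] assms(2)
  note surj = surj_of_continuous_limits[OF assms(2,3,4)]
  note distr = distr_stieltjes_shift[OF assms(1-4), of "S a"]
  have [simp]: "S x \<le> S y \<longleftrightarrow> x \<le> y" "S x < S y \<longleftrightarrow> x < y" for x y
    using assms(1) by (auto simp: strict_mono_less_eq strict_mono_less)
  have [measurable]: "S \<in> borel_measurable borel"
    using S(2) by (rule borel_measurable_continuous_onI)
  have m: "finite_measure m"
    using assms(6) sets_eq_imp_space_eq[OF assms(5)] by (intro finite_measureI) auto
  show "B_plus S m a \<le> A_plus S m a"
    unfolding B_plus_def A_plus_def
  proof (intro Inf_greatest SUP_least)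
    fix A x
    assume "A \<in> {A. \<forall>F \<in> dirichlet_domain S m. (\<integral>\<^sup>+x\<in>{a..}. ennreal ((F x - F a)\<^sup>2) \<partial>m)
       \<le> A * (\<integral>\<^sup>+x\<in>{a..}. ennreal ((dS_derivative S F x)\<^sup>2) \<partial>interval_measure S)}"
      and "x \<in> {a..}"
    then show "emeasure m {x<..} * ennreal (S x - S a) \<le> A"
      by (intro emeasure_mult_le_of_test[OF S m assms(5), where E="{a..}" and a=a]) auto
  qed
  show "B_minus S m a \<le> A_minus S m a"
    unfolding B_minus_def A_minus_def
  proof (intro Inf_greatest SUP_least)
    fix A x
    assume "A \<in> {A. \<forall>F \<in> dirichlet_domain S m. (\<integral>\<^sup>+x\<in>{..a}. ennreal ((F x - F a)\<^sup>2) \<partial>m)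
       \<le> A * (\<integral>\<^sup>+x\<in>{..a}. ennreal ((dS_derivative S F x)\<^sup>2) \<partial>interval_measure S)}"
      and "x \<in> {..a}"
    then show "emeasure m {..<x} * ennreal (S a - S x) \<le> A"
      by (intro emeasure_mult_le_of_test[OF S m assms(5), where E="{..a}" and a=a]) auto
  qed
  show "A_plus S m a \<le> 4 * B_plus S m a"
    unfolding A_plus_def
  proof (intro Inf_lower CollectI ballI)
    fix F assume F: "F \<in> dirichlet_domain S m"
    have tail: "emeasure m {x. t < S x - S a} * ennreal t \<le> B_plus S m a" if "0 < t" for t
    proof -
      \<comment> \<open>Surjectivity supplies the point at level \<open>t\<close>; the superlevel
        set is then exactly a ray starting at \<open>x\<close>, so the product is one of the terms
        of the supremum \<open>B_plus\<close>.\<close>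
      obtain x where x: "S x = S a + t" using surj by (metis surjD)
      have "t < S y - S a \<longleftrightarrow> x < y" for y
        using x strict_mono_less[OF assms(1), of x y] by linarith
      then have "emeasure m {y. t < S y - S a} * ennreal t = emeasure m {x<..} * ennreal (S x - S a)"
        using x by (simp add: greaterThan_def)
      moreover have "a \<le> x" using x that strict_mono_less_eq[OF assms(1), of a x] by linarith
      ultimately show ?thesis unfolding B_plus_def by (auto intro: SUP_upper2[of x])
    qed
    show "(\<integral>\<^sup>+x\<in>{a..}. ennreal ((F x - F a)\<^sup>2) \<partial>m)
       \<le> 4 * B_plus S m a * (\<integral>\<^sup>+x\<in>{a..}. ennreal ((dS_derivative S F x)\<^sup>2) \<partial>interval_measure S)"
      by (rule dirichlet_hardy[OF S m assms(5) F _ distr(1) tail]) auto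
  qed
  show "A_minus S m a \<le> 4 * B_minus S m a"
    unfolding A_minus_def
  proof (intro Inf_lower CollectI ballI)
    fix F assume F: "F \<in> dirichlet_domain S m"
    have tail: "emeasure m {x. t < S a - S x} * ennreal t \<le> B_minus S m a" if "0 < t" for t
    proof -
      obtain x where x: "S x = S a - t" using surj by (metis surjD)
      \<comment> \<open>The coordinate \<open>S a - S\<close> decreases, so its superlevel sets are
        left rays.\<close>
      have "t < S a - S y \<longleftrightarrow> y < x" for y
        using x strict_mono_less[OF assms(1), of y x] by linarith
      then have "emeasure m {y. t < S a - S y} * ennreal t = emeasure m {..<x} * ennreal (S a - S x)"
        using x by (simp add: lessThan_def)
      moreover have "x \<le> a" using x that strict_mono_less_eq[OF assms(1), of x a] by linarith
      ultimately show ?thesis unfolding B_minus_def by (auto intro: SUP_upper2[of x])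
    qed
    show "(\<integral>\<^sup>+x\<in>{..a}. ennreal ((F x - F a)\<^sup>2) \<partial>m)
       \<le> 4 * B_minus S m a * (\<integral>\<^sup>+x\<in>{..a}. ennreal ((dS_derivative S F x)\<^sup>2) \<partial>interval_measure S)"
      by (rule dirichlet_hardy[OF S m assms(5) F _ distr(2) tail]) auto
  qed
qed

end
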